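(* Let $A,B\in\mathbb{R}^{n\times n}$ be symmetric positive definite, let $\mu_1>\mu_2>\dots>\mu_m>0$ be the distinct eigenvalues (of arbitrary multiplicity) of the generalized eigenvalue problem $Bx=\mu Ax$, and for nonzero $x\in\mathbb{R}^n$ let $\mu(x)=\dfrac{x^TBx}{x^TAx}$. Let $T\in\mathbb{R}^{n\times n}$ be a (not necessarily symmetric or positive definite) matrix and $\gamma$ a real number such that $$s_{\max}\left(I-A^{1/2}TA^{1/2}\right)\le\gamma<1 .$$ Let $x\in\mathbb{R}^n$ be nonzero with $\mu_{i+1}<\mu(x)<\mu_i$ for some $i\in\{1,\dots,m-1\}$, and set $$x'=x+\frac{1}{\mu(x)}\,T\bigl(Bx-\mu(x)Ax\bigr).$$ Then either $\mu(x')\ge\mu_i$ or $$0<\frac{\mu_i-\mu(x')}{\mu(x')-\mu_{i+1}}\le\sigma^2\,\frac{\mu_i-\mu(x)}{\mu(x)-\mu_{i+1}},\qquad \sigma=\gamma+(1-\gamma)\frac{\mu_{i+1}}{\mu_i}.$$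
   Context: $s_{\max}(M)$ denotes the largest singular value of the real matrix $M$; $A^{1/2}$ is the symmetric positive definite square root of $A$; $I$ is the identity matrix. Since $\mu(\cdot)$ is only defined on nonzero vectors, the assertion includes that $x'\neq 0$. *)

theory Defs
  imports "HOL-Analysis.Analysis"
begin

definition sym_pos_def :: "real^'n^'n \<Rightarrow> bool" where
  "sym_pos_def A \<longleftrightarrow> transpose A = A \<and> (\<forall>x. x \<noteq> 0 \<longrightarrow> x \<bullet> (A *v x) > 0)"

text \<open>Only real eigenvalues are collected; for symmetric \<open>B\<close> and symmetric positive definite \<open>A\<close>
  there are no others.\<close>

definition gen_eigenvalues :: "real^'n^'n \<Rightarrow> real^'n^'n \<Rightarrow> real set" where
  "gen_eigenvalues B A = {\<mu>. \<exists>x. x \<noteq> 0 \<and> B *v x = \<mu> *\<^sub>R (A *v x)}"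

definition rayleigh :: "real^'n^'n \<Rightarrow> real^'n^'n \<Rightarrow> real^'n \<Rightarrow> real" where
  "rayleigh B A x = (x \<bullet> (B *v x)) / (x \<bullet> (A *v x))"

text \<open>The description is meaningful only for symmetric positive definite \<open>A\<close>, which has exactly one
  symmetric positive definite square root.\<close>

definition matrix_sqrt :: "real^'n^'n \<Rightarrow> real^'n^'n" where
  "matrix_sqrt A = (THE S. sym_pos_def S \<and> S ** S = A)"

text \<open>The singular values of \<open>M\<close> are the nonnegative square roots of the eigenvalues of
  \<open>M\<^sup>T M\<close>. They form a finite nonempty set, so that \<open>Max\<close> is the genuine maximum.\<close>

definition singular_values :: "real^'n^'n \<Rightarrow> real set" where
  "singular_values M = {s. s \<ge> 0 \<and> (\<exists>v. v \<noteq> 0 \<and> (transpose M ** M) *v v = s\<^sup>2 *\<^sub>R v)}"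

definition s_max :: "real^'n^'n \<Rightarrow> real" where
  "s_max M = Max (singular_values M)"

end

theory Submission
  imports Defs
begin

text \<open>With \<open>S = A\<^bsup>1/2\<^esup>\<close>, \<open>M = S\<^sup>-\<^sup>1 B S\<^sup>-\<^sup>1\<close>, \<open>y = S x\<close>, \<open>d = \<mu>(x)\<close> and \<open>w = d S x'\<close>, the iteration becomes
  \<open>w = M y - E (M y - d y)\<close> with \<open>E = I - S T S\<close>, so \<open>w\<close> lies in the ball around \<open>M y\<close> of radius
  \<open>\<gamma> |M y - d y|\<close>. The claim says \<open>w \<bullet> (M - t) w \<ge> 0\<close> for the number \<open>t\<close> at which the asserted bound
  is attained. A linear combination of this form with the constraints \<open>y \<bullet> (M - d) y = 0\<close> and
  \<open>|w - M y|\<^sup>2 \<le> \<gamma>\<^sup>2 |M y - d y|\<^sup>2\<close> (Lagrange multipliers, as in the S-procedure) splits along an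
  eigenbasis of \<open>M\<close> into binary quadratic forms, one for each eigenvalue \<open>\<lambda>\<close>. The determinant of
  such a form is a cubic in \<open>\<lambda>\<close> that is nonnegative on the positive axis outside the gap
  between \<open>\<mu>\<^bsub>i+1\<^esub>\<close> and \<open>\<mu>\<^bsub>i\<^esub>\<close>.\<close>

section \<open>Scalar inequalities: a cubic in the eigenvalue and its weighted sums\<close>

text \<open>Here \<open>P\<close> has the root \<open>b\<close>, satisfies \<open>P 0 \<ge> 0\<close>, \<open>P d < 0\<close> and \<open>P a \<ge> 0\<close>, and has leading
  coefficient \<open>1 - c\<^sup>2 > 0\<close>. So its other roots lie in \<open>(-\<infinity>, 0]\<close> and \<open>(d, a]\<close>.\<close>

lemma cubic_nonneg:
  fixes a b c d e lam s t :: real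
  defines "P \<equiv> \<lambda>l. (l - t) * l^2 - (c * (l - b) + b) * (l - d) * (c * (l - b) + b * s)"
  assumes "0 < b" "b < d" "d < a" "0 \<le> c" "c < 1" "s \<ge> 1"
    and s: "t - b = s * (d - b)"
    and a: "P a \<ge> 0" and td: "d < t"
    and lam: "0 < lam" "lam \<le> b \<or> a \<le> lam"
  shows "P lam \<ge> 0"
proof -
  \<comment> \<open>The quotient of \<open>P l\<close> by \<open>l - b\<close>; it is a quadratic
    with leading coefficient \<open>1 - c^2\<close>.\<close>
  define q where "q l = (1 - c^2) * l^2 + (c^2 * d + c^2 * b - b * c * s - c * b + b - t) * l
    - b * (1 - c) * (s - c) * d" for l
  have t: "t = b + s * (d - b)" using s by simp
  have P: "P l = (l - b) * q l" for l
    unfolding P_def q_def t by (simp add: power2_eq_square algebra_simps)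
  have c2: "1 - c^2 > 0" using assms by (simp add: power_less_one_iff abs_square_less_1)
  have q0: "q 0 \<le> 0" unfolding q_def using assms by simp
  have qd: "q d < 0"
  proof -
    have "P d < 0" unfolding P_def using assms by (simp add: mult_neg_pos)
    thus ?thesis using P[of d] \<open>b < d\<close> by (simp add: mult_less_0_iff)
  qed
  have qa: "q a \<ge> 0" using a P[of a] assms by (simp add: zero_le_mult_iff)
  \<comment> \<open>Convexity of \<open>q\<close> with exact remainder. It carries signs inward,
    from \<open>0\<close> and \<open>d\<close> to \<open>lam \<le> b\<close>, and outward, from
    \<open>d\<close> and \<open>a\<close> to \<open>lam \<ge> a\<close>.\<close>
  have conv: "(z - x) * q y = (z - y) * q x + (y - x) * q z - (1 - c^2) * (z - y) * (y - x) * (z - x)"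
    for x y z unfolding q_def by (simp add: power2_eq_square algebra_simps)
  show ?thesis
  proof (cases "lam \<le> b")
    case True
    have "d * q lam \<le> 0"
    proof -
      have "(d - lam) * q 0 \<le> 0" "lam * q d \<le> 0" using True assms q0 qd
        by (auto simp: mult_le_0_iff)
      moreover have "(1 - c^2) * (d - lam) * lam * d \<ge> 0" using c2 True assms by simp
      ultimately show ?thesis using conv[of d 0 lam] by simp
    qed
    hence "q lam \<le> 0" using assms by (simp add: mult_le_0_iff)
    thus ?thesis unfolding P using True by (simp add: zero_le_mult_iff)
  next
    case False
    hence al: "a \<le> lam" using lam by simp
    have "(a - d) * q lam \<ge> 0"
    proof -
      have "(lam - d) * q a \<ge> 0" "(lam - a) * q d \<le> 0" using al assms qa qd
        by (auto simp: mult_le_0_iff)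
      moreover have "(1 - c^2) * (lam - a) * (a - d) * (lam - d) \<ge> 0" using c2 al assms by simp
      ultimately show ?thesis using conv[of lam d a] by (simp add: algebra_simps)
    qed
    hence "q lam \<ge> 0" using assms by (simp add: zero_le_mult_iff)
    thus ?thesis unfolding P using al assms by simp
  qed
qed

text \<open>The estimate in eigenbasis coordinates: \<open>lam j\<close> are the eigenvalues,
  \<open>mean\<close> makes \<open>d\<close> the Rayleigh quotient of \<open>y\<close>, and
  \<open>t\<close> is the value at which the asserted bound is an equality. For \<open>c > 0\<close>
  the sum is bounded below by a combination of the constraints whose terms \<open>F j\<close> are
  nonnegative one by one.\<close>

lemma sum_shift_nonneg:
  fixes y w lam :: "'i \<Rightarrow> real" and a b c d :: real
  defines "s \<equiv> c + (1 - c) * (b / a)"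
  assumes b: "0 < b" "b < d" "d < a" and c: "0 \<le> c" "c < 1"
    and lam: "\<And>j. j \<in> J \<Longrightarrow> 0 < lam j" "\<And>j. j \<in> J \<Longrightarrow> lam j \<le> b \<or> a \<le> lam j"
    and fin: "finite J"
    and mean: "(\<Sum>j\<in>J. (lam j - d) * (y j)^2) = 0"
    and ball: "(\<Sum>j\<in>J. (w j - lam j * y j)^2) \<le> c^2 * (\<Sum>j\<in>J. (lam j - d)^2 * (y j)^2)"
    and t: "a - t = s^2 * ((a - d) / (d - b)) * (t - b)"
  shows "(\<Sum>j\<in>J. (lam j - t) * (w j)^2) \<ge> 0"
proof -
  have a0: "a > 0" using b by simp
  have as: "a * s = b + c * (a - b)" using a0 unfolding s_def by (simp add: field_simps)
  have s0: "0 < s"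
  proof -
    have "0 < b + c * (a - b)" using b c by (simp add: add_pos_nonneg)
    thus ?thesis using as a0 by (metis zero_less_mult_pos)
  qed
  have s1: "s < 1"
  proof -
    have "0 < (1 - c) * (a - b)" using b c by simp
    hence "a * s < a * 1" using as by (simp add: algebra_simps)
    thus ?thesis using a0 by simp
  qed
  \<comment> \<open>Measures \<open>t - b\<close> in units of \<open>d - b\<close>; it is the
    parameter \<open>s\<close> of \<open>cubic_nonneg\<close>, whereas \<open>s\<close> here is the
    convergence factor.\<close>
  define \<tau> where "\<tau> = (t - b) / (d - b)"
  have tau: "t - b = \<tau> * (d - b)" using b unfolding \<tau>_def by simp
  have at: "a - t = s^2 * \<tau> * (a - d)" using t unfolding \<tau>_def by simp
  \<comment> \<open>Strict contraction \<open>s^2 < 1\<close> forces progress: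
    \<open>b < t \<le> d\<close> in the equation for \<open>t\<close> would give
    \<open>a - t < a - d\<close>.\<close>
  have td: "d < t"
  proof (rule ccontr)
    assume "\<not> d < t"
    hence td: "t \<le> d" by simp
    have r: "(a - d) / (d - b) > 0" using b by simp
    have s2: "s^2 < 1" using s0 s1 by (simp add: power_less_one_iff abs_square_less_1)
    have tb: "t > b"
    proof (rule ccontr)
      assume "\<not> t > b"
      hence "s^2 * ((a - d) / (d - b)) * (t - b) \<le> 0"
        using r by (intro mult_nonneg_nonpos mult_nonneg_nonneg) auto
      thus False using t \<open>\<not> t > b\<close> b by linarith
    qed
    have "a - t < 1 * ((a - d) / (d - b)) * (t - b)"
      unfolding t using s2 r tb by (intro mult_strict_right_mono) auto
    also have "\<dots> \<le> ((a - d) / (d - b)) * (d - b)"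
      using r td by (simp del: times_divide_eq_left)
    also have "\<dots> = a - d" using b by simp
    finally show False using td by simp
  qed
  have tau1: "\<tau> \<ge> 1" unfolding \<tau>_def using td b by simp
  define P where "P l = (l - t) * l^2 - (c * (l - b) + b) * (l - d) * (c * (l - b) + b * \<tau>)" for l
  \<comment> \<open>The form of the convergence factor enters here: at \<open>a\<close> the factor
    \<open>c * (l - b) + b\<close> becomes \<open>a * s\<close>, and \<open>P a\<close> splits into
    nonnegative factors.\<close>
  have Pa: "P a \<ge> 0"
  proof -
    have as': "c * (a - b) + b = a * s" using as by simp
    have "P a = (a * s) * (a - d) * ((a * s) * \<tau> - c * (a - b) - b * \<tau>)"
      unfolding P_def at as' by (simp add: power2_eq_square algebra_simps)
    also have "\<dots> = (a * s) * (a - d) * (c * (a - b) * (\<tau> - 1))"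
      unfolding as by (simp add: algebra_simps)
    also have "\<dots> \<ge> 0" using a0 s0 b c tau1 by simp
    finally show ?thesis .
  qed
  have Pl: "P (lam j) \<ge> 0" if "j \<in> J" for j
    using cubic_nonneg[of b d a c \<tau> t "lam j"] b c tau1 tau Pa td lam[OF that]
    unfolding P_def by blast
  show ?thesis
  \<comment> \<open>The multiplier of the target sum below is \<open>c\<close>, so
    \<open>c = 0\<close> is treated apart; there the ball is a single point and \<open>w\<close> is
    determined by \<open>y\<close>.\<close>
  proof (cases "c = 0")
    case True
    have "(\<Sum>j\<in>J. (w j - lam j * y j)^2) = 0" using ball True
        sum_nonneg[of J "\<lambda>j. (w j - lam j * y j)^2"] by simp
    hence w: "w j = lam j * y j" if "j \<in> J" for j
      using that fin by (simp add: sum_nonneg_eq_0_iff)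
    have "(\<Sum>j\<in>J. (lam j - t) * (w j)^2)
        = (\<Sum>j\<in>J. P (lam j) * (y j)^2 + b^2 * \<tau> * ((lam j - d) * (y j)^2))"
      by (rule sum.cong) (auto simp: w P_def True power2_eq_square algebra_simps)
    also have "\<dots> = (\<Sum>j\<in>J. P (lam j) * (y j)^2)"
      by (simp add: sum.distrib sum_distrib_left[symmetric] mean)
    also have "\<dots> \<ge> 0" by (intro sum_nonneg) (simp add: Pl)
    finally show ?thesis .
  next
    case False
    hence c0: "c > 0" using c by simp
    \<comment> \<open>The multipliers are \<open>g\<close> for \<open>ball\<close> and
      \<open>g * h\<close> for \<open>mean\<close>. The choice of \<open>g\<close> makes the
      coefficient of \<open>(w j)^2\<close> in \<open>F j\<close> equal to
      \<open>c * (lam j - b) + b > 0\<close>; the choice of \<open>h\<close> makes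
      \<open>c^2 * (l - d) + h\<close> equal to \<open>c * (c * (l - b) + b * \<tau>)\<close>, as in
      \<open>P\<close>.\<close>
    define g where "g = c * (t - b) + b"
    have g: "g > 0" unfolding g_def using c0 td b by (simp add: add_pos_pos)
    define h where "h = c * (c * (d - b) + b * \<tau>)"
    define F where "F j = c * ((lam j - t) * (w j)^2) + g * (w j - lam j * y j)^2
      - g * c^2 * ((lam j - d)^2 * (y j)^2) - g * h * ((lam j - d) * (y j)^2)" for j
    \<comment> \<open>\<open>F j\<close> is a quadratic form in \<open>(y j, w j)\<close>; its determinant is a positive multiple of \<open>P (lam j)\<close>.\<close>
    have F: "F j \<ge> 0" if j: "j \<in> J" for j
    proof -
      define l where "l = c * (lam j - b) + b"
      have "l = c * lam j + (1 - c) * b" unfolding l_def by (simp add: algebra_simps)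
      hence l: "l > 0" using c0 c b lam(1)[OF j] by (simp add: add_pos_pos)
      have "l * F j = (l * w j - g * lam j * y j)^2 + g * c * P (lam j) * (y j)^2"
        unfolding F_def P_def h_def l_def g_def by (simp add: power2_eq_square algebra_simps)
      also have "\<dots> \<ge> 0" using g c0 Pl[OF j] by simp
      finally show ?thesis using l by (simp add: zero_le_mult_iff)
    qed
    have "0 \<le> (\<Sum>j\<in>J. F j)" by (rule sum_nonneg) (rule F)
    also have "\<dots> = c * (\<Sum>j\<in>J. (lam j - t) * (w j)^2) + g * (\<Sum>j\<in>J. (w j - lam j * y j)^2)
      - g * c^2 * (\<Sum>j\<in>J. (lam j - d)^2 * (y j)^2)"
      unfolding F_def sum.distrib sum_subtractf sum_distrib_left[symmetric] mean by simp
    also have "\<dots> \<le> c * (\<Sum>j\<in>J. (lam j - t) * (w j)^2)"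
      using mult_left_mono[OF ball, of g] g by (simp add: algebra_simps)
    finally show ?thesis using c0 by (simp add: zero_le_mult_iff)
  qed
qed

section \<open>Spectral theorem for self-adjoint maps\<close>

text \<open>A maximizer \<open>v\<close> of \<open>v \<bullet> f v\<close> on the unit sphere of
  \<open>S\<close> is an eigenvector: otherwise moving along the residual
  \<open>z = f v - c v\<close> would increase the quotient to first order.\<close>

lemma invariant_subspace_has_eigenvector:
  fixes f :: "'a::euclidean_space \<Rightarrow> 'a"
  assumes f: "linear f" and adj: "\<And>x y. x \<bullet> f y = f x \<bullet> y"
    and S: "subspace S" "f ` S \<subseteq> S" "S \<noteq> {0}"
  obtains v where "v \<in> S" "norm v = 1" "f v = (v \<bullet> f v) *\<^sub>R v"
proof -
  interpret f: linear f by fact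
  let ?K = "sphere 0 1 \<inter> S"
  obtain u where u: "u \<in> S" "u \<noteq> 0" using S subspace_0 by blast
  have "u /\<^sub>R norm u \<in> ?K" using u S by (simp add: subspace_scale)
  hence ne: "?K \<noteq> {}" by blast
  have "compact ?K" using closed_subspace[OF S(1)] by (simp add: compact_Int_closed)
  moreover have "continuous_on ?K (\<lambda>v. v \<bullet> f v)"
    using f by (intro continuous_intros linear_continuous_on_compose[of _ _ f]) auto
  ultimately obtain v where v: "v \<in> ?K" and vmax: "\<And>z. z \<in> ?K \<Longrightarrow> z \<bullet> f z \<le> v \<bullet> f v"
    using continuous_attains_sup[OF _ ne] by blast
  define c where "c = v \<bullet> f v"
  have vv: "v \<bullet> v = 1" using v by (simp add: dot_square_norm)
  have q: "w \<bullet> f w \<le> c * (w \<bullet> w)" if w: "w \<in> S" for w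
  proof (cases "w = 0")
    case False
    have "w /\<^sub>R norm w \<in> ?K" using w False S by (simp add: subspace_scale)
    from vmax[OF this] show ?thesis using False
      by (simp add: f.scale c_def field_simps dot_square_norm power2_eq_square)
  qed (simp add: f.zero)
  define z where "z = f v - c *\<^sub>R v"
  have zS: "z \<in> S" unfolding z_def using v S by (auto intro!: subspace_diff subspace_scale)
  have zv: "z \<bullet> v = 0" unfolding z_def by (simp add: inner_diff vv c_def inner_commute)
  hence zfv: "z \<bullet> f v = z \<bullet> z" unfolding z_def by (simp add: inner_diff_right inner_diff_left inner_commute)
  have key: "2 * e * (z \<bullet> z) \<le> e^2 * (c * (z \<bullet> z) - z \<bullet> f z)" for e
  proof -
    have "v + e *\<^sub>R z \<in> S" using v zS S by (auto intro!: subspace_add subspace_scale)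
    from q[OF this] show ?thesis
      using adj[of v z] zv zfv vv by (simp add: f.add f.scale inner_add inner_commute c_def
          power2_eq_square algebra_simps)
  qed
  have "z = 0"
  proof (rule ccontr)
    assume "z \<noteq> 0"
    hence zz: "z \<bullet> z > 0" by simp
    define k where "k = c * (z \<bullet> z) - z \<bullet> f z"
    have k0: "k \<ge> 0" using q[OF zS] unfolding k_def by simp
    \<comment> \<open>Small enough that \<open>e * k\<close> cannot reach
      \<open>2 * (z \<bullet> z)\<close>; the summand \<open>1\<close> covers
      \<open>k = 0\<close>.\<close>
    define e where "e = (z \<bullet> z) / (k + 1)"
    have e: "e > 0" unfolding e_def using zz k0 by simp
    have "2 * (z \<bullet> z) * e \<le> e * k * e" using key[of e] unfolding k_def by (simp add: power2_eq_square algebra_simps)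
    hence "2 * (z \<bullet> z) \<le> e * k" using e by (simp add: mult.commute)
    moreover have "e * (k + 1) = z \<bullet> z" using k0 unfolding e_def by simp
    ultimately show False using e zz by (simp add: algebra_simps)
  qed
  thus ?thesis using that[of v] v unfolding z_def c_def by auto
qed

text \<open>Induction on the dimension: split off a unit eigenvector \<open>v\<close>.
  Self-adjointness keeps its orthogonal complement in \<open>S\<close> invariant.\<close>

lemma selfadjoint_eigenbasis_on:
  fixes f :: "'a::euclidean_space \<Rightarrow> 'a"
  assumes f: "linear f" and adj: "\<And>x y. x \<bullet> f y = f x \<bullet> y"
    and S: "subspace S" "f ` S \<subseteq> S"
  shows "\<exists>U. U \<subseteq> S \<and> pairwise orthogonal U \<and> (\<forall>u\<in>U. norm u = 1 \<and> f u = (u \<bullet> f u) *\<^sub>R u) \<and> span U = S"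
  using S
proof (induction "dim S" arbitrary: S rule: less_induct)
  case less
  show ?case
  proof (cases "S = {0}")
    case True
    thus ?thesis by (intro exI[of _ "{}"]) simp
  next
    case False
    then obtain v where v: "v \<in> S" "norm v = 1" "f v = (v \<bullet> f v) *\<^sub>R v"
      using invariant_subspace_has_eigenvector[OF f adj] less.prems by blast
    have vv: "v \<bullet> v = 1" using v by (simp add: dot_square_norm)
    define S' where "S' = {x \<in> S. v \<bullet> x = 0}"
    have sub: "subspace S'" using less.prems(1) unfolding S'_def subspace_def
      by (auto simp: inner_add_right)
    have inv: "f ` S' \<subseteq> S'"
    proof -
      have "v \<bullet> f x = 0" if "v \<bullet> x = 0" for x
        using adj[of v x] that by (subst (asm) v(3)) simp
      thus ?thesis using less.prems(2) unfolding S'_def by auto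
    qed
    have "v \<notin> S'" unfolding S'_def by (simp add: vv)
    hence "S' \<subset> S" using v unfolding S'_def by blast
    hence "dim S' < dim S" using sub less.prems(1)
      by (metis dim_psubset span_eq_iff)
    from less.hyps[OF this sub inv] obtain U where U: "U \<subseteq> S'" "pairwise orthogonal U"
      "\<forall>u\<in>U. norm u = 1 \<and> f u = (u \<bullet> f u) *\<^sub>R u" "span U = S'" by blast
    have "span (insert v U) = S"
    proof
      show "span (insert v U) \<subseteq> S"
        using U v less.prems(1) unfolding S'_def by (intro span_minimal) auto
      show "S \<subseteq> span (insert v U)"
      proof
        fix x assume x: "x \<in> S"
        have "x - (v \<bullet> x) *\<^sub>R v \<in> S'" unfolding S'_def using x v less.prems(1)
          by (auto simp: inner_diff_right vv intro!: subspace_diff subspace_scale)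
        thus "x \<in> span (insert v U)" unfolding span_insert U(4) by blast
      qed
    qed
    moreover have "pairwise orthogonal (insert v U)"
      using U unfolding S'_def by (auto simp: pairwise_insert orthogonal_def inner_commute)
    ultimately show ?thesis using U v unfolding S'_def
      by (intro exI[of _ "insert v U"]) auto
  qed
qed

section \<open>Orthonormal eigenbases of symmetric matrices\<close>

lemma symmetric_dot: "transpose M = M \<Longrightarrow> x \<bullet> (M *v y) = (M *v x) \<bullet> (y::real^'n)"
  by (metis dot_lmul_matrix vector_transpose_matrix)

locale orthonormal_basis =
  fixes U :: "'a::euclidean_space set"
  assumes finite: "finite U" and orthogonal: "pairwise orthogonal U"
    and norm: "\<And>u. u \<in> U \<Longrightarrow> norm u = 1" and span: "span U = UNIV"
begin

lemma expand: "(\<Sum>u\<in>U. (u \<bullet> x) *\<^sub>R u) = x"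
  using orthonormal_basis_expand[OF orthogonal norm _ finite, of x] span
  by (simp add: inner_commute)

lemma inner_expand: "x \<bullet> y = (\<Sum>u\<in>U. (u \<bullet> x) * (u \<bullet> y))"
proof -
  have "x \<bullet> y = (\<Sum>u\<in>U. (u \<bullet> x) *\<^sub>R u) \<bullet> y" by (simp only: expand)
  thus ?thesis by (simp add: inner_sum_left)
qed

lemma eqI: "(\<And>u. u \<in> U \<Longrightarrow> u \<bullet> x = u \<bullet> y) \<Longrightarrow> x = y"
  using expand[of x] expand[of y] by (metis (no_types, lifting) sum.cong)

lemma nonzero_coefficient:
  assumes "x \<noteq> 0"
  obtains u where "u \<in> U" "u \<bullet> x \<noteq> 0"
  using eqI[of x 0] assms by (metis inner_zero_right)

lemma inner_basis: "u \<in> U \<Longrightarrow> v \<in> U \<Longrightarrow> u \<bullet> v = (if u = v then 1 else 0)"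
  using orthogonal norm by (auto simp: pairwise_def orthogonal_def dot_square_norm)

lemma nonempty: "U \<noteq> {}"
  using nonzero_coefficient[of "SOME b. b \<in> Basis"] SOME_Basis nonzero_Basis by blast

end

locale matrix_eigenbasis = orthonormal_basis U for U :: "(real^'n) set" +
  fixes M :: "real^'n^'n" and d :: "real^'n \<Rightarrow> real"
  assumes sym: "transpose M = M" and eigen: "\<And>u. u \<in> U \<Longrightarrow> M *v u = d u *\<^sub>R u"
begin

lemma inner_image: "u \<in> U \<Longrightarrow> u \<bullet> (M *v x) = d u * (u \<bullet> x)"
  using symmetric_dot[OF sym, of u x] eigen by simp

lemma nonzero: "u \<in> U \<Longrightarrow> u \<noteq> 0"
  using norm by fastforce

end

lemma symmetric_matrix_eigenbasis:
  fixes M :: "real^'n^'n"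
  assumes "transpose M = M"
  obtains U d where "matrix_eigenbasis U M d"
proof -
  obtain U where U: "pairwise orthogonal U" "\<forall>u\<in>U. norm u = 1 \<and> M *v u = (u \<bullet> (M *v u)) *\<^sub>R u"
     "span U = UNIV"
    using selfadjoint_eigenbasis_on[of "(*v) M" UNIV] symmetric_dot[OF assms] by auto
  have "finite U" using U(1) pairwise_orthogonal_imp_finite by blast
  with U assms have "matrix_eigenbasis U M (\<lambda>u. u \<bullet> (M *v u))"
    by unfold_locales auto
  thus ?thesis using that by blast
qed

lemma transpose_eqI:
  fixes M :: "real^'n^'n"
  assumes "\<And>x y. x \<bullet> (M *v y) = (M *v x) \<bullet> y"
  shows "transpose M = M"
proof -
  have "x \<bullet> (transpose M *v y) = x \<bullet> (M *v y)" for x y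
    using assms by (metis dot_lmul_matrix inner_commute vector_transpose_matrix transpose_transpose)
  thus ?thesis by (metis matrix_eq vector_eq_rdot inner_commute)
qed

section \<open>The positive definite square root\<close>

text \<open>Justifies the description in \<open>matrix_sqrt\<close>. Existence takes roots of the
  eigenvalues; uniqueness holds because every such root acts on the eigenbasis of \<open>A\<close>
  in the same way.\<close>

lemma sym_pos_def_sqrt_ex1:
  fixes A :: "real^'n^'n"
  assumes A: "sym_pos_def A"
  shows "\<exists>!S. sym_pos_def S \<and> S ** S = A"
proof -
  obtain U d where "matrix_eigenbasis U A d"
    using symmetric_matrix_eigenbasis A unfolding sym_pos_def_def by blast
  then interpret matrix_eigenbasis U A d .
  have d: "d u > 0" if u: "u \<in> U" for u
  proof -
    have "0 < u \<bullet> (A *v u)" using A nonzero[OF u] unfolding sym_pos_def_def by blast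
    thus ?thesis using inner_image[OF u, of u] inner_basis[OF u u] by simp
  qed
  define f where "f x = (\<Sum>u\<in>U. (sqrt (d u) * (u \<bullet> x)) *\<^sub>R u)" for x
  define S where "S = matrix f"
  have "linear f" unfolding f_def
    by (rule linearI) (simp_all add: inner_add_right distrib_left scaleR_add_left sum.distrib
        scaleR_sum_right mult.left_commute)
  hence Sx: "S *v x = f x" for x
    unfolding S_def by (intro matrix_works) (simp add: linear_def scalar_mult_eq_scaleR)
  have Su: "u \<bullet> (S *v x) = sqrt (d u) * (u \<bullet> x)" if u: "u \<in> U" for u x
  proof -
    have "u \<bullet> (S *v x) = (\<Sum>v\<in>U. if v = u then sqrt (d u) * (u \<bullet> x) else 0)"
      unfolding Sx f_def inner_sum_right by (rule sum.cong) (auto simp: inner_basis[OF u])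
    thus ?thesis using u finite by simp
  qed
  have "transpose S = S"
  proof (rule transpose_eqI)
    fix x y
    show "x \<bullet> (S *v y) = (S *v x) \<bullet> y"
      unfolding inner_expand[of x] inner_expand[of "S *v x"] by (auto simp: Su intro!: sum.cong)
  qed
  moreover have "x \<bullet> (S *v x) > 0" if "x \<noteq> 0" for x
  proof -
    obtain u where "u \<in> U" "u \<bullet> x \<noteq> 0" using nonzero_coefficient[OF \<open>x \<noteq> 0\<close>] .
    hence "0 < (\<Sum>u\<in>U. sqrt (d u) * (u \<bullet> x)^2)"
      using finite d by (intro sum_pos2[of U u]) (simp_all add: less_imp_le)
    also have "\<dots> = x \<bullet> (S *v x)"
      unfolding inner_expand[of x] by (auto simp: Su power2_eq_square intro!: sum.cong)
    finally show ?thesis .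
  qed
  moreover have "S ** S = A"
  proof -
    have "(S ** S) *v x = A *v x" for x
      unfolding matrix_vector_mul_assoc[symmetric]
      by (rule eqI) (use d in \<open>simp add: Su inner_image less_imp_le flip: mult.assoc\<close>)
    thus ?thesis by (simp add: matrix_eq)
  qed
  moreover have "R = S" if R: "sym_pos_def R" "R ** R = A" for R
  proof -
    have Ru: "R *v u = sqrt (d u) *\<^sub>R u" if u: "u \<in> U" for u
    proof -
      \<comment> \<open>From \<open>R ** R = A\<close>, the map \<open>R + sqrt (d u)\<close> sends
        \<open>z\<close> to zero; being positive definite, it forces \<open>z = 0\<close>.\<close>
      define z where "z = R *v u - sqrt (d u) *\<^sub>R u"
      have "R *v z + sqrt (d u) *\<^sub>R z = (R ** R) *v u - (sqrt (d u) * sqrt (d u)) *\<^sub>R u"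
        unfolding z_def by (simp add: matrix_vector_mul_assoc[symmetric] algebra_simps
            matrix_vector_mult_scaleR)
      also have "\<dots> = 0" unfolding R(2) using eigen[OF u] d[OF u] by simp
      finally have "z \<bullet> (R *v z) + sqrt (d u) * (z \<bullet> z) = 0"
        by (metis inner_add_right inner_scaleR_right inner_zero_right)
      moreover have "z \<bullet> (R *v z) \<ge> 0" using R(1) unfolding sym_pos_def_def
        by (cases "z = 0") (auto intro: less_imp_le)
      moreover have "sqrt (d u) * (z \<bullet> z) \<ge> 0" using d[OF u] by simp
      ultimately have "sqrt (d u) * (z \<bullet> z) = 0" by linarith
      hence "z = 0" using d[OF u] by simp
      thus ?thesis unfolding z_def by simp
    qed
    have "transpose R = R" using R(1) unfolding sym_pos_def_def by blast
    hence "u \<bullet> (R *v x) = u \<bullet> (S *v x)" if "u \<in> U" for u x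
      using that symmetric_dot[of R u x] Ru by (simp add: Su)
    thus ?thesis by (metis eqI matrix_eq)
  qed
  ultimately show ?thesis unfolding sym_pos_def_def by blast
qed

lemma matrix_sqrt:
  assumes "sym_pos_def A"
  shows "sym_pos_def (matrix_sqrt A)" "matrix_sqrt A ** matrix_sqrt A = A"
  using theI'[OF sym_pos_def_sqrt_ex1[OF assms]] unfolding matrix_sqrt_def by auto

section \<open>The largest singular value as a bound for the operator norm\<close>

text \<open>In an eigenbasis of \<open>transpose M ** M\<close> the squared norm of
  \<open>M *v x\<close> is the sum of \<open>d u * (u \<bullet> x)^2\<close>, and the singular
  values are the numbers \<open>sqrt (d u)\<close>.\<close>

lemma s_max_bound:
  fixes M :: "real^'n^'n"
  shows s_max_nonneg: "0 \<le> s_max M"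
    and norm_le_s_max: "norm (M *v x) \<le> s_max M * norm x"
proof -
  let ?N = "transpose M ** M"
  have N: "y \<bullet> (?N *v z) = (M *v y) \<bullet> (M *v z)" for y z
    by (metis dot_lmul_matrix matrix_vector_mul_assoc transpose_transpose vector_transpose_matrix)
  have "transpose ?N = ?N" by (simp add: matrix_transpose_mul)
  then obtain U d where "matrix_eigenbasis U ?N d"
    using symmetric_matrix_eigenbasis by blast
  then interpret matrix_eigenbasis U ?N d .
  have d: "d u \<ge> 0" if "u \<in> U" for u
    using N[of u u] inner_image[OF that, of u] inner_basis[OF that that] by simp
  \<comment> \<open>This inclusion yields finiteness, without which \<open>Max\<close> would carry
    no information.\<close>
  have "singular_values M \<subseteq> (\<lambda>u. sqrt (d u)) ` U"
  proof
    fix s assume "s \<in> singular_values M"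
    then obtain v where s: "s \<ge> 0" "v \<noteq> 0" "?N *v v = s\<^sup>2 *\<^sub>R v"
      unfolding singular_values_def by blast
    obtain u where u: "u \<in> U" "u \<bullet> v \<noteq> 0" using nonzero_coefficient[OF s(2)] .
    hence "d u = s\<^sup>2" using inner_image[OF u(1), of v] s(3) by simp
    thus "s \<in> (\<lambda>u. sqrt (d u)) ` U" using u s(1) by (auto intro!: image_eqI[of _ _ u])
  qed
  hence fin: "finite (singular_values M)" using finite finite_subset by blast
  have "sqrt (d u) \<in> singular_values M" if "u \<in> U" for u
    unfolding singular_values_def using eigen[OF that] d[OF that] nonzero[OF that] by auto
  hence le: "sqrt (d u) \<le> s_max M" if "u \<in> U" for u
    unfolding s_max_def using that fin by simp
  show nn: "0 \<le> s_max M"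
    using nonempty le d by (meson all_not_in_conv order_trans real_sqrt_ge_zero)
  have "(norm (M *v x))\<^sup>2 = (\<Sum>u\<in>U. d u * (u \<bullet> x)^2)"
    unfolding dot_square_norm[symmetric] N[symmetric] inner_expand[of x]
    by (auto simp: inner_image power2_eq_square intro!: sum.cong)
  also have "\<dots> \<le> (\<Sum>u\<in>U. (s_max M)\<^sup>2 * (u \<bullet> x)^2)"
    using le by (intro sum_mono mult_right_mono) (auto simp: sqrt_le_D)
  also have "\<dots> = (s_max M * norm x)\<^sup>2"
    unfolding power_mult_distrib dot_square_norm[symmetric, of x] inner_expand[of x x]
    by (simp add: sum_distrib_left power2_eq_square)
  finally show "norm (M *v x) \<le> s_max M * norm x"
    by (rule power2_le_imp_le) (simp add: nn)
qed

section \<open>The estimate for one symmetric matrix\<close>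

lemma rayleigh_shift_nonneg:
  fixes M :: "real^'n^'n" and y w :: "real^'n" and a b c d t :: real
  assumes M: "transpose M = M" and y: "y \<noteq> 0" and d: "y \<bullet> (M *v y) = d * (y \<bullet> y)"
    and gap: "\<And>l u. u \<noteq> 0 \<Longrightarrow> M *v u = l *\<^sub>R u \<Longrightarrow> 0 < l \<and> (l \<le> b \<or> a \<le> l)"
    and b: "0 < b" "b < d" "d < a" and c: "0 \<le> c" "c < 1"
    and w: "norm (w - M *v y) \<le> c * norm (M *v y - d *\<^sub>R y)"
    and t: "a - t = (c + (1 - c) * (b / a))^2 * ((a - d) / (d - b)) * (t - b)"
  shows "t * (w \<bullet> w) \<le> w \<bullet> (M *v w)" and "w \<noteq> 0"
proof -
  obtain U l where "matrix_eigenbasis U M l" using symmetric_matrix_eigenbasis[OF M] .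
  then interpret matrix_eigenbasis U M l .
  have nsq: "(norm x)\<^sup>2 = (\<Sum>u\<in>U. (u \<bullet> x)^2)" for x
    unfolding dot_square_norm[symmetric] inner_expand[of x] by (simp add: power2_eq_square)
  have shift: "x \<bullet> (M *v x) - s * (x \<bullet> x) = (\<Sum>u\<in>U. (l u - s) * (u \<bullet> x)^2)" for x s
    unfolding inner_expand[of x] by (simp add: sum_distrib_left inner_image power2_eq_square
        algebra_simps flip: sum_subtractf)
  have w2: "(norm (w - M *v y))\<^sup>2 \<le> c\<^sup>2 * (norm (M *v y - d *\<^sub>R y))\<^sup>2"
    using power_mono[OF w, of 2] by (simp add: power_mult_distrib)
  have "0 \<le> (\<Sum>u\<in>U. (l u - t) * (u \<bullet> w)^2)"
  proof (rule sum_shift_nonneg[of b d a c U l "\<lambda>u. u \<bullet> y"])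
    show "(\<Sum>u\<in>U. (l u - d) * (u \<bullet> y)\<^sup>2) = 0" using d shift[of y d] by simp
    show "(\<Sum>u\<in>U. (u \<bullet> w - l u * (u \<bullet> y))\<^sup>2) \<le> c\<^sup>2 * (\<Sum>u\<in>U. (l u - d)\<^sup>2 * (u \<bullet> y)\<^sup>2)"
      using w2 unfolding nsq
      by (simp add: inner_diff_right inner_image power_mult_distrib flip: left_diff_distrib)
  qed (use b c t gap nonzero eigen finite in auto)
  thus "t * (w \<bullet> w) \<le> w \<bullet> (M *v w)" using shift[of w t] by simp
  \<comment> \<open>The residual \<open>M *v y - d *\<^sub>R y\<close> is orthogonal to
    \<open>y\<close>, hence strictly shorter than \<open>M *v y\<close>, so the ball around
    \<open>M *v y\<close> misses the origin.\<close>
  show "w \<noteq> 0"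
  proof
    assume "w = 0"
    define r where "r = M *v y - d *\<^sub>R y"
    have My: "M *v y = r + d *\<^sub>R y" unfolding r_def by simp
    have "r \<bullet> y = 0" unfolding r_def using d
      by (simp add: inner_diff_left inner_commute[of "M *v y"])
    hence "(norm (M *v y))\<^sup>2 = (norm r)\<^sup>2 + d\<^sup>2 * (norm y)\<^sup>2"
      unfolding My dot_square_norm[symmetric]
      by (simp add: inner_add inner_commute power2_eq_square)
    moreover have "norm (M *v y) \<le> norm r"
    proof -
      have "c * norm r \<le> 1 * norm r" using c by (intro mult_right_mono) auto
      thus ?thesis using w \<open>w = 0\<close> unfolding r_def by simp
    qed
    hence "(norm (M *v y))\<^sup>2 \<le> (norm r)\<^sup>2" by (simp add: power_mono)
    moreover have "d\<^sup>2 * (norm y)\<^sup>2 > 0" using b y by simp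
    ultimately show False by linarith
  qed
qed

section \<open>Reduction of the generalized eigenvalue problem to a symmetric matrix\<close>

theorem theorem2p1:
  fixes A B T :: "real^'n^'n"
    and mu :: "nat \<Rightarrow> real" and m i :: nat
    and \<gamma> \<sigma> :: real
    and x x' :: "real^'n"
  assumes "sym_pos_def A" and "sym_pos_def B"
    and "gen_eigenvalues B A = mu ` {1..m}"
    and "strict_antimono_on {1..m} mu" and "mu m > 0"
    and "s_max (mat 1 - matrix_sqrt A ** T ** matrix_sqrt A) \<le> \<gamma>" and "\<gamma> < 1"
    and "x \<noteq> 0"
    and "1 \<le> i" and "i < m"
    and "mu (i + 1) < rayleigh B A x" and "rayleigh B A x < mu i"
    and "x' = x + (1 / rayleigh B A x) *\<^sub>R (T *v (B *v x - rayleigh B A x *\<^sub>R (A *v x)))"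
    and "\<sigma> = \<gamma> + (1 - \<gamma>) * (mu (i + 1) / mu i)"
  shows "x' \<noteq> 0 \<and>
    (rayleigh B A x' \<ge> mu i \<or>
      (0 < (mu i - rayleigh B A x') / (rayleigh B A x' - mu (i + 1)) \<and>
       (mu i - rayleigh B A x') / (rayleigh B A x' - mu (i + 1))
         \<le> \<sigma>\<^sup>2 * ((mu i - rayleigh B A x) / (rayleigh B A x - mu (i + 1)))))"
proof -
  define S where "S = matrix_sqrt A"
  define a b d where "a = mu i" and "b = mu (i + 1)" and "d = rayleigh B A x"
  have S: "sym_pos_def S" "S ** S = A" using matrix_sqrt[OF assms(1)] unfolding S_def by auto
  have symS: "transpose S = S" and symB: "transpose B = B"
    using S(1) assms(2) unfolding sym_pos_def_def by auto
  have "S *v z = 0 \<Longrightarrow> z = 0" for z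
    using S(1) unfolding sym_pos_def_def by (metis inner_zero_right less_irrefl)
  then obtain R where RS: "R ** S = mat 1" using matrix_left_invertible_ker by blast
  hence SR: "S ** R = mat 1" by (rule matrix_left_right_inverse1)
  have [simp]: "R *v (S *v z) = z" "S *v (R *v z) = z" for z
    by (simp_all add: matrix_vector_mul_assoc RS SR)
  have symR: "transpose R = R"
    by (metis RS SR matrix_mul_assoc matrix_mul_lid matrix_mul_rid matrix_transpose_mul symS
        transpose_mat)
  \<comment> \<open>With \<open>R\<close> the inverse of \<open>S\<close>, substituting
    \<open>S *v z\<close> for \<open>z\<close> turns \<open>A\<close> into the identity and
    \<open>B\<close> into \<open>M\<close>, so \<open>rayleigh B A\<close> becomes the ordinary
    Rayleigh quotient of \<open>M\<close>.\<close>
  define M where "M = R ** B ** R"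
  have Mv: "M *v z = R *v (B *v (R *v z))" for z
    unfolding M_def by (simp add: matrix_vector_mul_assoc matrix_mul_assoc)
  have symM: "transpose M = M"
    unfolding M_def by (simp add: matrix_transpose_mul symR symB matrix_mul_assoc)
  have Av: "A *v z = S *v (S *v z)" for z using S(2) by (simp add: matrix_vector_mul_assoc)
  have Bv: "B *v z = S *v (M *v (S *v z))" for z by (simp add: Mv)
  have ray: "rayleigh B A z = (S *v z) \<bullet> (M *v (S *v z)) / ((S *v z) \<bullet> (S *v z))" for z
    unfolding rayleigh_def Av Bv by (simp only: symmetric_dot[OF symS])
  have mu: "mu k < mu j" if "j < k" "j \<in> {1..m}" "k \<in> {1..m}" for j k
    using assms(4) that unfolding monotone_on_def by blast
  have b0: "0 < b"
    using mu[of "i + 1" m] assms(5,9,10) unfolding b_def by (cases "i + 1 = m") auto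
  have bda: "b < d" "d < a" using assms(11,12) unfolding a_def b_def d_def by auto
  \<comment> \<open>If \<open>u\<close> is an eigenvector of \<open>M\<close>, then
    \<open>R *v u\<close> solves the generalized problem, so \<open>l\<close> is some
    \<open>mu j\<close>; no index lies strictly between \<open>i\<close> and
    \<open>i + 1\<close>.\<close>
  have gap: "0 < l \<and> (l \<le> b \<or> a \<le> l)" if u: "u \<noteq> 0" "M *v u = l *\<^sub>R u" for l u
  proof -
    have "R *v u \<noteq> 0" using u(1) by (metis \<open>\<And>z. S *v (R *v z) = z\<close> matrix_vector_mult_0_right)
    moreover have "B *v (R *v u) = l *\<^sub>R (A *v (R *v u))"
      using u(2) unfolding Av Bv by (simp add: matrix_vector_mult_scaleR)
    ultimately have "l \<in> mu ` {1..m}"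
      using assms(3) unfolding gen_eigenvalues_def by blast
    then obtain j where j: "j \<in> {1..m}" "l = mu j" by blast
    have "0 < l" using mu[of j m] j assms(5) by (cases "j = m") auto
    moreover have "a \<le> l" if "j \<le> i"
      using mu[of j i] j assms(9,10) that unfolding a_def by (cases "j = i") auto
    moreover have "l \<le> b" if "\<not> j \<le> i"
      using mu[of "i + 1" j] j assms(9,10) that unfolding b_def by (cases "j = i + 1") auto
    ultimately show ?thesis by blast
  qed
  \<comment> \<open>Scaling by \<open>d\<close> removes the factor \<open>1 / d\<close> from the
    iteration and leaves Rayleigh quotients unchanged.\<close>
  define y w where "y = S *v x" and "w = d *\<^sub>R (S *v x')"
  have y: "y \<noteq> 0" using assms(8) unfolding y_def by (metis \<open>\<And>z. R *v (S *v z) = z\<close> matrix_vector_mult_0_right)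
  have dy: "y \<bullet> (M *v y) = d * (y \<bullet> y)"
    using y unfolding d_def ray y_def[symmetric] by simp
  define E where "E = mat 1 - S ** T ** S"
  have E: "w - M *v y = - (E *v (M *v y - d *\<^sub>R y))"
  proof -
    have "B *v x - d *\<^sub>R (A *v x) = S *v (M *v y - d *\<^sub>R y)"
      unfolding Av Bv y_def by (simp add: matrix_vector_mult_diff_distrib matrix_vector_mult_scaleR)
    hence "w = d *\<^sub>R y + S *v (T *v (S *v (M *v y - d *\<^sub>R y)))"
      using bda b0 unfolding w_def assms(13) d_def[symmetric] y_def[symmetric]
      by (simp add: y_def matrix_vector_right_distrib matrix_vector_mult_scaleR scaleR_add_right)
    thus ?thesis unfolding E_def
      by (simp add: matrix_vector_mult_diff_rdistrib matrix_vector_mul_assoc[symmetric])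
  qed
  have sm: "s_max E \<le> \<gamma>" using assms(6) unfolding E_def S_def .
  have g: "0 \<le> \<gamma>" using s_max_nonneg[of E] sm by linarith
  have ball: "norm (w - M *v y) \<le> \<gamma> * norm (M *v y - d *\<^sub>R y)"
    unfolding E norm_minus_cancel
    using norm_le_s_max[of E "M *v y - d *\<^sub>R y"] mult_right_mono[OF sm norm_ge_zero] by (rule order_trans)
  define K where "K = \<sigma>\<^sup>2 * ((a - d) / (d - b))"
  have K: "K \<ge> 0" using bda unfolding K_def by simp
  \<comment> \<open>The weighted mean of \<open>a\<close> and \<open>b\<close> that solves
    \<open>(a - t) / (t - b) = K\<close>.\<close>
  define t where "t = (a + K * b) / (1 + K)"
  have at: "a - t = K * (t - b)" using K unfolding t_def by (simp add: field_simps)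
  have tb: "b < t" using K bda unfolding t_def by (simp add: field_simps)
  have "t * (w \<bullet> w) \<le> w \<bullet> (M *v w)" and w0: "w \<noteq> 0"
    using rayleigh_shift_nonneg[OF symM y dy gap b0 bda g assms(7) ball, where t = t] at
    unfolding K_def assms(14) a_def b_def by auto
  hence "t * (w \<bullet> w) \<le> rayleigh B A x' * (w \<bullet> w)"
    unfolding ray w_def by (simp add: matrix_vector_mult_scaleR ac_simps)
  hence t: "t \<le> rayleigh B A x'" using w0 by simp
  have "x' \<noteq> 0" using w0 unfolding w_def by auto
  \<comment> \<open>On \<open>b < r\<close> the ratio decreases in \<open>r\<close>, so
    \<open>t \<le> r\<close> suffices; \<open>r \<ge> a\<close> is the first alternative of the
    claim.\<close>
  moreover have "0 < (a - r) / (r - b) \<and> (a - r) / (r - b) \<le> K" if "t \<le> r" "r < a" for r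
  proof -
    have "a - r \<le> K * (t - b)" using that(1) at by simp
    also have "\<dots> \<le> K * (r - b)" using that(1) K by (simp add: mult_left_mono)
    finally show ?thesis using that tb by (simp add: divide_le_eq)
  qed
  ultimately show ?thesis
    using t unfolding K_def a_def b_def d_def by force
qed

end
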